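(* Let $X$ be a nonempty set. An operation $F\colon X^2\to X$ is $(2,3)$-selective if and only if $|\mathrm{ran}(F)|=1$.
   Context: An operation $F\colon X^2\to X$ is $(2,3)$-selective if $F(F(x_1,x_2),F(x_3,x_4))=F(x_2,x_3)$ for all $x_1,x_2,x_3,x_4\in X$. $\mathrm{ran}(F)$ denotes the range of $F$. *)

theory Defs
  imports "HOL-Library.FuncSet"
begin

definition selective_2_3_on :: "'a set \<Rightarrow> ('a \<times> 'a \<Rightarrow> 'a) \<Rightarrow> bool" where
  "selective_2_3_on X F \<longleftrightarrow>
     (\<forall>x1\<in>X. \<forall>x2\<in>X. \<forall>x3\<in>X. \<forall>x4\<in>X. F (F (x1, x2), F (x3, x4)) = F (x2, x3))"

end

theory Submission
  imports Defs
begin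

text \<open>Write \<open>xy\<close> for \<open>F (x, y)\<close>. Evaluating \<open>((uu)(du))((ef)(uu))\<close> from the inside gives
  \<open>(ud)(fu) = df\<close>, while applying selectivity to the outermost product gives
  \<open>(du)(ef) = ue\<close>. Hence \<open>df = ue\<close> for arbitrary \<open>d, f, u, e\<close>.\<close>

lemma selective_2_3_on_constant:
  assumes F: "F \<in> X \<times> X \<rightarrow> X" and sel: "selective_2_3_on X F"
    and X: "d \<in> X" "f \<in> X" "u \<in> X" "e \<in> X"
  shows "F (d, f) = F (u, e)"
proof -
  have closed: "F (x, y) \<in> X" if "x \<in> X" "y \<in> X" for x y
    using F that by auto
  have s: "F (F (x, y), F (z, w)) = F (y, z)"
    if "x \<in> X" "y \<in> X" "z \<in> X" "w \<in> X" for x y z w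
    using sel that unfolding selective_2_3_on_def by blast
  let ?t = "F (F (F (u, u), F (d, u)), F (F (e, f), F (u, u)))"
  have "?t = F (F (u, d), F (f, u))"
    by (simp only: s X)
  also have "\<dots> = F (d, f)"
    by (simp only: s X)
  finally have "?t = F (d, f)" .
  \<comment> \<open>Contracting the outermost product first means applying selectivity to four
    arguments that are themselves products, so closure of \<open>X\<close> under \<open>F\<close>
    enters here.\<close>
  moreover have "?t = F (F (d, u), F (e, f))"
    by (rule s) (intro closed X)+
  moreover have "\<dots> = F (u, e)"
    by (simp only: s X)
  ultimately show ?thesis by simp
qed

theorem proposition2p12:
  fixes X :: "'a set" and F :: "'a \<times> 'a \<Rightarrow> 'a"
  assumes "X \<noteq> {}"
    and "F \<in> X \<times> X \<rightarrow> X"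
  shows "selective_2_3_on X F \<longleftrightarrow> card (F ` (X \<times> X)) = 1"
proof
  assume sel: "selective_2_3_on X F"
  obtain a where a: "a \<in> X" using assms(1) by blast
  have "F p = F (a, a)" if "p \<in> X \<times> X" for p
    using that by (elim SigmaE) (simp only:, rule selective_2_3_on_constant[OF assms(2) sel _ _ a a])
  then have "F ` (X \<times> X) = {F (a, a)}"
    using a by blast
  then show "card (F ` (X \<times> X)) = 1" by simp
next
  assume "card (F ` (X \<times> X)) = 1"
  \<comment> \<open>Since \<open>card\<close> is 0 on infinite sets, the value 1 gives a genuine
    singleton even for infinite \<open>X\<close>.\<close>
  then obtain k where "F ` (X \<times> X) = {k}"
    by (rule card_1_singletonE)
  then have k: "F (x, y) = k" if "x \<in> X" "y \<in> X" for x y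
    using that by blast
  \<comment> \<open>As \<open>X\<close> is nonempty, \<open>k\<close> is attained and lies in
    \<open>X\<close>; hence \<open>F (k, k) = k\<close>, the value of both sides of
    selectivity.\<close>
  have "k \<in> X" using assms k by fastforce
  then show "selective_2_3_on X F"
    unfolding selective_2_3_on_def by (simp add: k)
qed

end
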